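(* Let $m$ and $l$ be two stable means and let $M$ be an $(l,m)$-stabilizable mean. Let $m_v$ be an $m$-weighted mean and $l_v$ an $l$-weighted mean ($v\in[0,1]$). Then the family $(M_v)_{v\in[0,1]}$ defined for $a,b>0$ by $$M_v(a,b)=l_v\Big(M\big(m_v(a,b),a\big),\,M\big(m_v(a,b),b\big)\Big)$$ is an $M$-weighted mean.
   Context: A (binary) mean is a map $m:(0,\infty)^2\to(0,\infty)$ with $\min(a,b)\le m(a,b)\le\max(a,b)$ for all $a,b>0$. It is symmetric if $m(a,b)=m(b,a)$. The means $\min$ and $\max$ are called trivial. A weighted mean is a family $(m_v)_{v\in[0,1]}$ of binary maps such that: (i) $m_v$ is a mean for every $v\in[0,1]$; (ii) $m_{1/2}$ is a symmetric mean; (iii) $m_v(a,b)=m_{1-v}(b,a)$ for all $a,b>0$, $v\in[0,1]$. If $m$ is a symmetric mean, a weighted mean $(m_v)$ with $m_{1/2}=m$ is called an $m$-weighted mean. For symmetric means $m_1,m_2,m_3$, the resultant mean-map is $$\mathcal R(m_1,m_2,m_3)(a,b)=m_1\Big(m_2\big(a,m_3(a,b)\big),\,m_2\big(m_3(a,b),b\big)\Big),\quad a,b>0.$$ A symmetric mean $m$ is stable if $\mathcal R(m,m,m)=m$. A symmetric mean $m$ is stabilizable if there are two nontrivial stable means $m_1,m_2$ such that $\mathcal R(m_1,m,m_2)=m$; one then says that $m$ is $(m_1,m_2)$-stabilizable. *)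

theory Defs
  imports Complex_Main
begin

text \<open>A map on the open positive quadrant is represented by a function
  \<open>real \<Rightarrow> real \<Rightarrow> real\<close> whose values outside the quadrant are irrelevant; accordingly,
  equality of such maps is the relation \<open>eq_pos\<close>, not HOL equality.\<close>

definition eq_pos :: "(real \<Rightarrow> real \<Rightarrow> real) \<Rightarrow> (real \<Rightarrow> real \<Rightarrow> real) \<Rightarrow> bool" where
  "eq_pos f g \<longleftrightarrow> (\<forall>a>0. \<forall>b>0. f a b = g a b)"

text \<open>The lower bound forces the values on the quadrant to be positive.\<close>

definition is_mean :: "(real \<Rightarrow> real \<Rightarrow> real) \<Rightarrow> bool" where
  "is_mean m \<longleftrightarrow> (\<forall>a>0. \<forall>b>0. min a b \<le> m a b \<and> m a b \<le> max a b)"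

definition symmetric_mean :: "(real \<Rightarrow> real \<Rightarrow> real) \<Rightarrow> bool" where
  "symmetric_mean m \<longleftrightarrow> is_mean m \<and> (\<forall>a>0. \<forall>b>0. m a b = m b a)"

definition trivial_mean :: "(real \<Rightarrow> real \<Rightarrow> real) \<Rightarrow> bool" where
  "trivial_mean m \<longleftrightarrow> eq_pos m min \<or> eq_pos m max"

definition resultant ::
  "(real \<Rightarrow> real \<Rightarrow> real) \<Rightarrow> (real \<Rightarrow> real \<Rightarrow> real) \<Rightarrow> (real \<Rightarrow> real \<Rightarrow> real) \<Rightarrow> real \<Rightarrow> real \<Rightarrow> real" where
  "resultant m1 m2 m3 a b = m1 (m2 a (m3 a b)) (m2 (m3 a b) b)"

definition stable_mean :: "(real \<Rightarrow> real \<Rightarrow> real) \<Rightarrow> bool" where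
  "stable_mean m \<longleftrightarrow> symmetric_mean m \<and> eq_pos (resultant m m m) m"

definition stabilizable_by ::
  "(real \<Rightarrow> real \<Rightarrow> real) \<Rightarrow> (real \<Rightarrow> real \<Rightarrow> real) \<Rightarrow> (real \<Rightarrow> real \<Rightarrow> real) \<Rightarrow> bool" where
  "stabilizable_by m1 m2 m \<longleftrightarrow>
     symmetric_mean m \<and>
     stable_mean m1 \<and> \<not> trivial_mean m1 \<and>
     stable_mean m2 \<and> \<not> trivial_mean m2 \<and>
     eq_pos (resultant m1 m m2) m"

text \<open>A family \<open>(m\<^sub>v)\<close> indexed by \<open>v \<in> [0,1]\<close> is a function of \<open>v :: real\<close> that is
  constrained only for \<open>v \<in> {0..1}\<close>.\<close>

definition weighted_mean :: "(real \<Rightarrow> real \<Rightarrow> real \<Rightarrow> real) \<Rightarrow> bool" where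
  "weighted_mean w \<longleftrightarrow>
     (\<forall>v\<in>{0..1}. is_mean (w v)) \<and>
     symmetric_mean (w (1/2)) \<and>
     (\<forall>v\<in>{0..1}. \<forall>a>0. \<forall>b>0. w v a b = w (1 - v) b a)"

definition weighted_mean_of ::
  "(real \<Rightarrow> real \<Rightarrow> real) \<Rightarrow> (real \<Rightarrow> real \<Rightarrow> real \<Rightarrow> real) \<Rightarrow> bool" where
  "weighted_mean_of m w \<longleftrightarrow> symmetric_mean m \<and> weighted_mean w \<and> eq_pos (w (1/2)) m"

end

theory Submission imports Defs begin

text \<open>Each axiom of a weighted mean passes through the nested formula. The value m_v(a,b) lies
  in the interval from min(a,b) to max(a,b), so both values of M lie there too, and so does the
  value of l_v at them. Replacing (v,a,b) by (1-v,b,a) keeps m_v(a,b) and exchanges the two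
  arguments of the outer mean, which the passage from l_v to l_{1-v} undoes. At v = 1/2, symmetry of
  M turns the formula into the resultant of l, M, m, which is M by stabilizability.\<close>

text \<open>The bounds are free rather than \<open>min x y\<close> and \<open>max x y\<close>, so
  that one fixed interval can be carried through all the nested means.\<close>

lemma mean_between:
  assumes "is_mean f" "0 < x" "lo \<le> x" "x \<le> hi" "0 < y" "lo \<le> y" "y \<le> hi"
  shows "0 < f x y" "lo \<le> f x y" "f x y \<le> hi"
proof -
  have "min x y \<le> f x y" "f x y \<le> max x y"
    using assms by (auto simp: is_mean_def)
  then show "0 < f x y" "lo \<le> f x y" "f x y \<le> hi"
    using assms by linarith+
qed

theorem theorem6p1:
  fixes m l M :: "real \<Rightarrow> real \<Rightarrow> real"
    and mw lw Mw :: "real \<Rightarrow> real \<Rightarrow> real \<Rightarrow> real"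
  assumes "stable_mean m"
    and "stable_mean l"
    and "stabilizable_by l m M"
    and "weighted_mean_of m mw"
    and "weighted_mean_of l lw"
    and "\<And>v a b. v \<in> {0..1} \<Longrightarrow> a > 0 \<Longrightarrow> b > 0 \<Longrightarrow>
           Mw v a b = lw v (M (mw v a b) a) (M (mw v a b) b)"
  shows "weighted_mean_of M Mw"
proof -
  have symM: "symmetric_mean M" and stabM: "eq_pos (resultant l M m) M"
    using assms(3) by (auto simp: stabilizable_by_def)
  have M: "is_mean M" and M_commute: "\<And>a b. 0 < a \<Longrightarrow> 0 < b \<Longrightarrow> M a b = M b a"
    using symM by (auto simp: symmetric_mean_def)
  have mw: "is_mean (mw v)" and lw: "is_mean (lw v)" if "v \<in> {0..1}" for v
    using assms(4,5) that by (auto simp: weighted_mean_of_def weighted_mean_def)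
  have mw_swap: "mw v a b = mw (1 - v) b a" and lw_swap: "lw v a b = lw (1 - v) b a"
    if "v \<in> {0..1}" "0 < a" "0 < b" for v a b
    using assms(4,5)[unfolded weighted_mean_of_def weighted_mean_def] that by blast+
  have mw_half: "mw (1/2) a b = m a b" and lw_half: "lw (1/2) a b = l a b"
    if "0 < a" "0 < b" for a b
    using assms(4,5) that by (auto simp: weighted_mean_of_def eq_pos_def)

  have c: "0 < mw v a b" "min a b \<le> mw v a b" "mw v a b \<le> max a b"
    if "v \<in> {0..1}" "0 < a" "0 < b" for v a b
    using mean_between[OF mw[OF that(1)], of a "min a b" "max a b" b] that by auto
  \<comment> \<open>The two choices of \<open>x\<close> give both arguments of the outer mean. Their
    positivity is needed as well, since the laws for \<open>lw\<close> hold only on the open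
    quadrant.\<close>
  have Mc: "0 < M (mw v a b) x" "min a b \<le> M (mw v a b) x" "M (mw v a b) x \<le> max a b"
    if "v \<in> {0..1}" "0 < a" "0 < b" "x = a \<or> x = b" for v a b x
    using mean_between[OF M, of "mw v a b" "min a b" "max a b" x] c[OF that(1-3)] that by auto

  have mean: "is_mean (Mw v)" if v: "v \<in> {0..1}" for v
    unfolding is_mean_def
  proof (intro allI impI)
    fix a b :: real assume ab: "0 < a" "0 < b"
    show "min a b \<le> Mw v a b \<and> Mw v a b \<le> max a b"
      unfolding assms(6)[OF v ab]
      using mean_between(2,3)[OF lw[OF v] Mc[OF v ab, of a] Mc[OF v ab, of b]] by simp
  qed

  have swap: "Mw v a b = Mw (1 - v) b a" if v: "v \<in> {0..1}" and ab: "0 < a" "0 < b" for v a b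
  proof -
    have v': "1 - v \<in> {0..1}" using v by simp
    have "Mw v a b = lw (1 - v) (M (mw v a b) b) (M (mw v a b) a)"
      unfolding assms(6)[OF v ab] using lw_swap[OF v] Mc(1)[OF v ab] by simp
    \<comment> \<open>Swapping inside gives \<open>mw v a b = mw (1 - v) b a\<close>, so both sides
      share the same inner value.\<close>
    also have "\<dots> = Mw (1 - v) b a"
      unfolding assms(6)[OF v' ab(2,1)] mw_swap[OF v ab] ..
    finally show ?thesis .
  qed

  have half: "Mw (1/2) a b = M a b" if ab: "0 < a" "0 < b" for a b
  proof -
    have h: "(1/2::real) \<in> {0..1}" by simp
    have "Mw (1/2) a b = l (M (m a b) a) (M (m a b) b)"
      using assms(6)[OF h ab] Mc[OF h ab] by (simp add: mw_half lw_half ab)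
    \<comment> \<open>The resultant has \<open>a\<close> on the left in its first inner mean, so
      only that occurrence of \<open>M\<close> must be commuted.\<close>
    also have "\<dots> = resultant l M m a b"
      using M_commute[of "m a b" a] c(1)[OF h ab] ab by (simp add: resultant_def mw_half)
    also have "\<dots> = M a b"
      using stabM ab by (simp add: eq_pos_def)
    finally show ?thesis .
  qed

  have "symmetric_mean (Mw (1/2))"
    using mean[of "1/2"] half M_commute by (simp add: symmetric_mean_def)
  then show ?thesis
    unfolding weighted_mean_of_def weighted_mean_def eq_pos_def
    by (intro conjI ballI allI impI symM mean swap half)
qed

end
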